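(* Let $X$ be a nonempty subset of a normed space $Y$. Suppose that $X$ is a normed space under any norm $\|\cdot\|_X$ (in general different from the norm induced by $\|\cdot\|_Y$). If $X$ is a triangular bounded proximinal space in $Y$, then $$\|f\|_{\widetilde Y}:=\sup_{g\in P_X(f)}\|g\|_X,\qquad f\in Y,$$ is a seminorm on $Y$, and it is a norm on the quotient space $\widetilde Y:=Y^{\|\cdot\|}/\mathcal N$, where $Y^{\|\cdot\|}$ is $Y$ endowed with the seminorm $\|\cdot\|_{\widetilde Y}$ and $\mathcal N:=\{g\in Y:\|g\|_{\widetilde Y}=0\}$. Furthermore, $X=\mathrm{LH}(X,\widetilde Y)$; that is, $X$ is contained in $\widetilde Y$ (via $f\mapsto f+\mathcal N$, which is injective on $X$) and $\|f\|_X=\|f\|_{\widetilde Y}$ for every $f\in X$.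
   Context: $X$ carries the vector space structure inherited from $Y$ (it is a linear subspace of $Y$), and is endowed with its own norm $\|\cdot\|_X$. For $y\in Y$ let $P_X(y):=\{x\in X:\|y-x\|_Y=d(y,X)\}$, where $d(y,X)=\inf_{z\in X}\|y-z\|_Y$ (the set of best approximations to $y$ in $X$ with respect to $\|\cdot\|_Y$). $X$ is proximinal in $Y$ if $P_X(y)\ne\emptyset$ for all $y\in Y$. A normed proximinal space $X$ in $Y$ is triangular if $\sup_{x\in P_X(y_1+y_2)}\|x\|_X\le\sup_{x_1\in P_X(y_1)}\|x_1\|_X+\sup_{x_2\in P_X(y_2)}\|x_2\|_X$ for all $y_1,y_2\in Y$ (suprema are allowed to be infinite). It is bounded if $\sup_{x\in P_X(y)}\|x\|_X<+\infty$ for all $y\in Y$. "Triangular bounded proximinal" means proximinal, triangular and bounded. For normed spaces $X\subset Z$, $\mathrm{LH}(X,Z)=\{f\in X:\|f\|_X=\|f\|_Z\}$. The equality $X=\mathrm{LH}(X,\widetilde Y)$ means that the two have the same elements. *)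

theory Defs
  imports "HOL-Analysis.Analysis" "HOL-Library.Set_Algebras"
begin

text \<open>
  Scalars range over a type of class \<^class>\<open>real_normed_field\<close>, whose instances are, up to
  isomorphism, the real and the complex numbers; so both real and complex normed spaces are covered.
  Vector spaces are given by explicit operations on a carrier, because the subspace \<open>X\<close> and the
  quotient by \<open>\<N>\<close> (which depends on a term) are not types.
\<close>

locale vector_space_on =
  fixes V :: "'v set" and add :: "'v \<Rightarrow> 'v \<Rightarrow> 'v" and zero :: 'v
    and smul :: "'k::field \<Rightarrow> 'v \<Rightarrow> 'v"
  assumes add_closed: "\<And>x y. \<lbrakk>x \<in> V; y \<in> V\<rbrakk> \<Longrightarrow> add x y \<in> V"
    and zero_closed: "zero \<in> V"
    and scale_closed: "\<And>c x. x \<in> V \<Longrightarrow> smul c x \<in> V"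
    and add_assoc: "\<And>x y z. \<lbrakk>x \<in> V; y \<in> V; z \<in> V\<rbrakk> \<Longrightarrow> add (add x y) z = add x (add y z)"
    and add_commute: "\<And>x y. \<lbrakk>x \<in> V; y \<in> V\<rbrakk> \<Longrightarrow> add x y = add y x"
    and add_zero: "\<And>x. x \<in> V \<Longrightarrow> add zero x = x"
    and add_inverse: "\<And>x. x \<in> V \<Longrightarrow> \<exists>y\<in>V. add x y = zero"
    and scale_add: "\<And>c x y. \<lbrakk>x \<in> V; y \<in> V\<rbrakk> \<Longrightarrow> smul c (add x y) = add (smul c x) (smul c y)"
    and add_scale: "\<And>c d x. x \<in> V \<Longrightarrow> smul (c + d) x = add (smul c x) (smul d x)"
    and scale_scale: "\<And>c d x. x \<in> V \<Longrightarrow> smul c (smul d x) = smul (c * d) x"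
    and scale_one: "\<And>x. x \<in> V \<Longrightarrow> smul 1 x = x"

definition seminorm_on ::
    "'v set \<Rightarrow> ('v \<Rightarrow> 'v \<Rightarrow> 'v) \<Rightarrow> ('k::real_normed_field \<Rightarrow> 'v \<Rightarrow> 'v) \<Rightarrow> ('v \<Rightarrow> real) \<Rightarrow> bool" where
  "seminorm_on V add smul p \<longleftrightarrow>
     (\<forall>x\<in>V. 0 \<le> p x) \<and>
     (\<forall>x\<in>V. \<forall>y\<in>V. p (add x y) \<le> p x + p y) \<and>
     (\<forall>c. \<forall>x\<in>V. p (smul c x) = norm c * p x)"

definition norm_on ::
    "'v set \<Rightarrow> ('v \<Rightarrow> 'v \<Rightarrow> 'v) \<Rightarrow> 'v \<Rightarrow> ('k::real_normed_field \<Rightarrow> 'v \<Rightarrow> 'v) \<Rightarrow> ('v \<Rightarrow> real) \<Rightarrow> bool" where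
  "norm_on V add zero smul p \<longleftrightarrow>
     seminorm_on V add smul p \<and> (\<forall>x\<in>V. p x = 0 \<longrightarrow> x = zero)"

definition best_approx :: "'y::real_normed_vector set \<Rightarrow> 'y \<Rightarrow> 'y set" where
  "best_approx X y = {x \<in> X. norm (y - x) = infdist y X}"

definition proximinal :: "'y::real_normed_vector set \<Rightarrow> bool" where
  "proximinal X \<longleftrightarrow> (\<forall>y. best_approx X y \<noteq> {})"

text \<open>The supremum is taken in the extended reals, since it may be infinite.\<close>

definition sup_best_approx :: "'y::real_normed_vector set \<Rightarrow> ('y \<Rightarrow> real) \<Rightarrow> 'y \<Rightarrow> ereal" where
  "sup_best_approx X nX y = (SUP x\<in>best_approx X y. ereal (nX x))"

definition triangular :: "'y::real_normed_vector set \<Rightarrow> ('y \<Rightarrow> real) \<Rightarrow> bool" where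
  "triangular X nX \<longleftrightarrow>
     (\<forall>y1 y2. sup_best_approx X nX (y1 + y2) \<le> sup_best_approx X nX y1 + sup_best_approx X nX y2)"

definition bounded_proximinal :: "'y::real_normed_vector set \<Rightarrow> ('y \<Rightarrow> real) \<Rightarrow> bool" where
  "bounded_proximinal X nX \<longleftrightarrow> (\<forall>y. sup_best_approx X nX y < \<infinity>)"

definition triangular_bounded_proximinal :: "'y::real_normed_vector set \<Rightarrow> ('y \<Rightarrow> real) \<Rightarrow> bool" where
  "triangular_bounded_proximinal X nX \<longleftrightarrow>
     proximinal X \<and> triangular X nX \<and> bounded_proximinal X nX"

text \<open>
  A real supremum: it is only meaningful when the values of \<open>nX\<close> on \<open>best_approx X f\<close> form a
  nonempty bounded set, which is what proximinality and boundedness provide.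
\<close>

definition tilde_norm :: "'y::real_normed_vector set \<Rightarrow> ('y \<Rightarrow> real) \<Rightarrow> 'y \<Rightarrow> real" where
  "tilde_norm X nX f = (SUP g\<in>best_approx X f. nX g)"

definition null_space :: "('y \<Rightarrow> real) \<Rightarrow> 'y set" where
  "null_space p = {g. p g = 0}"

text \<open>
  The quotient by a subspace \<open>N\<close> consists of the cosets \<open>f +o N\<close>. Its addition is the
  elementwise sum of sets and its zero is \<open>N\<close>. In the scalar multiplication, adding \<open>N\<close> only
  matters for the scalar 0, where the image alone would be \<open>{0}\<close> instead of \<open>N\<close>.
\<close>

definition quot_carrier :: "'y::ab_group_add set \<Rightarrow> 'y set set" where
  "quot_carrier N = range (\<lambda>f. f +o N)"

definition quot_scale :: "('k \<Rightarrow> 'y \<Rightarrow> 'y) \<Rightarrow> 'y::ab_group_add set \<Rightarrow> 'k \<Rightarrow> 'y set \<Rightarrow> 'y set" where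
  "quot_scale smul N c A = smul c ` A + N"

text \<open>The common value of \<open>p\<close> on a coset; unspecified if \<open>p\<close> is not constant there.\<close>

definition quot_norm :: "('y \<Rightarrow> real) \<Rightarrow> 'y set \<Rightarrow> real" where
  "quot_norm p A = the_elem (p ` A)"

text \<open>\<open>LH(X, Z)\<close>, where \<open>X\<close> is regarded as a subset of \<open>Z\<close> by means of the map \<open>j\<close>.\<close>

definition LH :: "('x \<Rightarrow> 'z) \<Rightarrow> 'x set \<Rightarrow> ('x \<Rightarrow> real) \<Rightarrow> ('z \<Rightarrow> real) \<Rightarrow> 'x set" where
  "LH j X nX nZ = {f \<in> X. nX f = nZ (j f)}"

end

theory Submission imports Defs
begin

text \<open>
  Two facts carry the proof. The first is that best approximation commutes with nonzero scalars:
  multiplication by \<open>c \<noteq> 0\<close> maps the subspace \<open>X\<close> onto itself and multiplies all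
  distances by \<^term>\<open>norm c\<close>, so that it maps the best approximations to \<open>y\<close> onto those to
  \<open>c \<cdot> y\<close> (lemma \<open>best_approx_scale\<close>); hence the supremum of \<open>nX\<close> over the best
  approximations is absolutely homogeneous. Its subadditivity is triangularity, once
  proximinality and boundedness have identified the real supremum with the extended real one
  (lemma \<open>ereal_tilde_norm\<close>). The second fact is that a point of \<open>X\<close> has no best approximation
  other than itself (lemma \<open>best_approx_self\<close>), so the new seminorm coincides with \<open>nX\<close>
  on \<open>X\<close>. As \<open>nX\<close> is a norm, only the zero vector of \<open>X\<close> lies in the null space,
  which gives injectivity on \<open>X\<close>.

  The remaining claims hold for every seminorm on a vector space: its null space is a subspace, it is
  constant on the cosets of the null space, and it induces a norm on the quotient.
\<close>

section \<open>Quotients of vector spaces\<close>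

context vector_space
begin

lemma coset_eq_iff:
  assumes "subspace N"
  shows "f +o N = g +o N \<longleftrightarrow> f - g \<in> N"
proof
  assume "f +o N = g +o N"
  moreover have "f \<in> f +o N"
    using subspace_0[OF assms] by (force simp: elt_set_plus_def)
  ultimately show "f - g \<in> N"
    by (auto simp: elt_set_plus_def)
next
  have shift: "f +o N \<subseteq> g +o N" if "f - g \<in> N" for f g
  proof
    fix x assume "x \<in> f +o N"
    then obtain n where "n \<in> N" "x = f + n" by (auto simp: elt_set_plus_def)
    then have "x = g + ((f - g) + n)" "(f - g) + n \<in> N"
      using subspace_add[OF assms that] by auto
    then show "x \<in> g +o N" unfolding elt_set_plus_def by blast
  qed
  assume "f - g \<in> N"
  moreover from this have "g - f \<in> N"
    using subspace_neg[OF assms] by fastforce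
  ultimately show "f +o N = g +o N"
    using shift by blast
qed

lemma coset_add:
  assumes "subspace N"
  shows "(f + g) +o N = (f +o N) + (g +o N)"
proof -
  have "N + N = N"
  proof
    show "N + N \<subseteq> N" using subspace_add[OF assms] by (auto simp: set_plus_def)
    show "N \<subseteq> N + N" using subspace_0[OF assms] by (force simp: set_plus_def)
  qed
  then show ?thesis by (simp add: set_plus_rearrange)
qed

lemma coset_scale:
  assumes "subspace N"
  shows "scale c f +o N = quot_scale scale N c (f +o N)"
proof
  show "scale c f +o N \<subseteq> quot_scale scale N c (f +o N)"
    using subspace_0[OF assms]
    by (fastforce simp: quot_scale_def elt_set_plus_def set_plus_def)
  show "quot_scale scale N c (f +o N) \<subseteq> scale c f +o N"
  proof
    fix x assume "x \<in> quot_scale scale N c (f +o N)"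
    then obtain n m where "n \<in> N" "m \<in> N" "x = scale c (f + n) + m"
      by (auto simp: quot_scale_def elt_set_plus_def set_plus_def)
    then have "x = scale c f + (scale c n + m)" "scale c n + m \<in> N"
      using subspace_add[OF assms] subspace_scale[OF assms]
      by (auto simp: scale_right_distrib add.assoc)
    then show "x \<in> scale c f +o N" by (auto simp: elt_set_plus_def)
  qed
qed

text \<open>
  The axioms are inherited along the surjection \<open>f \<mapsto> f +o N\<close>, which respects the
  operations by \<open>coset_add\<close> and \<open>coset_scale\<close>; elementwise addition of sets is
  associative and commutative in any case.
\<close>

lemma quotient_vector_space_on:
  assumes "subspace N"
  shows "vector_space_on (quot_carrier N) (+) N (quot_scale scale N)"
proof -
  note add = coset_add[OF assms, symmetric] and scale = coset_scale[OF assms, symmetric]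
  have zero: "N = 0 +o N" by simp
  have coset: "\<exists>f. A = f +o N" if "A \<in> quot_carrier N" for A
    using that by (auto simp: quot_carrier_def)
  have carrier: "f +o N \<in> quot_carrier N" for f
    by (auto simp: quot_carrier_def)
  show ?thesis
  proof
    show "A + B \<in> quot_carrier N" if "A \<in> quot_carrier N" "B \<in> quot_carrier N" for A B
      using that carrier by (auto dest!: coset simp: add)
    show "N \<in> quot_carrier N"
      using carrier[of 0] by simp
    show "quot_scale scale N c A \<in> quot_carrier N" if "A \<in> quot_carrier N" for c A
      using that carrier by (auto dest!: coset simp: scale)
    show "A + B + C = A + (B + C)" for A B C :: "'b set"
      by (rule add.assoc)
    show "A + B = B + A" for A B :: "'b set"
      by (rule add.commute)
    show "N + A = A" if "A \<in> quot_carrier N" for A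
    proof -
      obtain f where "A = f +o N" using coset[OF \<open>A \<in> quot_carrier N\<close>] by blast
      then show ?thesis using add[of 0 f] by simp
    qed
    show "\<exists>B\<in>quot_carrier N. A + B = N" if "A \<in> quot_carrier N" for A
    proof -
      obtain f where "A = f +o N" using coset[OF \<open>A \<in> quot_carrier N\<close>] by blast
      then have "A + ((- f) +o N) = N" using add[of f "- f"] by simp
      then show ?thesis using carrier by blast
    qed
    show "quot_scale scale N c (A + B) = quot_scale scale N c A + quot_scale scale N c B"
      if "A \<in> quot_carrier N" "B \<in> quot_carrier N" for c A B
      using that by (auto dest!: coset simp: add scale scale_right_distrib)
    show "quot_scale scale N (c + d) A = quot_scale scale N c A + quot_scale scale N d A"
      if "A \<in> quot_carrier N" for c d A
      using that by (auto dest!: coset simp: add scale scale_left_distrib)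
    show "quot_scale scale N c (quot_scale scale N d A) = quot_scale scale N (c * d) A"
      if "A \<in> quot_carrier N" for c d A
      using that by (auto dest!: coset simp: scale)
    show "quot_scale scale N 1 A = A" if "A \<in> quot_carrier N" for A
      using that by (auto dest!: coset simp: scale)
  qed
qed

end

section \<open>The quotient by the null space of a seminorm\<close>

lemma
  assumes "seminorm_on V add smul p"
  shows seminorm_on_nonneg: "x \<in> V \<Longrightarrow> 0 \<le> p x"
    and seminorm_on_triangle: "x \<in> V \<Longrightarrow> y \<in> V \<Longrightarrow> p (add x y) \<le> p x + p y"
    and seminorm_on_scale: "x \<in> V \<Longrightarrow> p (smul c x) = norm c * p x"
  using assms by (auto simp: seminorm_on_def)

context
  fixes smul :: "'k::real_normed_field \<Rightarrow> 'y::ab_group_add \<Rightarrow> 'y" and p :: "'y \<Rightarrow> real"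
  assumes vs: "vector_space smul" and p: "seminorm_on UNIV (+) smul p"
begin

interpretation vector_space smul by (fact vs)

lemma null_space_subspace: "module.subspace smul (null_space p)"
proof (rule subspaceI)
  show "0 \<in> null_space p"
    using seminorm_on_scale[OF p, of 0 0] by (simp add: null_space_def)
  show "x + y \<in> null_space p" if "x \<in> null_space p" "y \<in> null_space p" for x y
    using that seminorm_on_triangle[OF p, of x y] seminorm_on_nonneg[OF p, of "x + y"]
    by (simp add: null_space_def)
  show "smul c x \<in> null_space p" if "x \<in> null_space p" for c x
    using that seminorm_on_scale[OF p, of x c] by (simp add: null_space_def)
qed

lemma seminorm_add_null:
  assumes "n \<in> null_space p"
  shows "p (f + n) = p f"
proof (rule antisym)
  show "p (f + n) \<le> p f"
    using assms seminorm_on_triangle[OF p, of f n] by (simp add: null_space_def)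
  have "- n \<in> null_space p"
    using assms subspace_neg[OF null_space_subspace] by blast
  then show "p f \<le> p (f + n)"
    using seminorm_on_triangle[OF p, of "f + n" "- n"] by (simp add: null_space_def)
qed

lemma quot_norm_coset: "quot_norm p (f +o null_space p) = p f"
proof -
  have "p ` (f +o null_space p) = {p f}"
    using seminorm_add_null subspace_0[OF null_space_subspace]
    by (force simp: elt_set_plus_def image_iff)
  then show ?thesis by (simp add: quot_norm_def)
qed

lemma quotient_norm_on:
  "norm_on (quot_carrier (null_space p)) (+) (null_space p) (quot_scale smul (null_space p))
    (quot_norm p)"
proof -
  let ?N = "null_space p"
  note add = coset_add[OF null_space_subspace, symmetric]
    and scale = coset_scale[OF null_space_subspace, symmetric]
  have "f +o ?N = ?N" if "p f = 0" for f
    using that coset_eq_iff[OF null_space_subspace, of f 0] by (simp add: null_space_def)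
  then show ?thesis
    using p unfolding norm_on_def seminorm_on_def quot_carrier_def
    by (auto simp: add scale quot_norm_coset)
qed

end

section \<open>Best approximation in a subspace\<close>

text \<open>
  The distance of \<open>x\<close> to \<open>X\<close> is zero, and the norm separates points.
\<close>

lemma best_approx_self:
  assumes "x \<in> X"
  shows "best_approx X x = {x}"
  using assms by (auto simp: best_approx_def)

text \<open>
  Multiplication by \<open>c\<close> permutes \<open>X\<close> and multiplies distances by \<^term>\<open>norm c\<close>. Since \<open>c\<close>
  is invertible, one inequality between the distances to \<open>X\<close> and one inclusion between the
  sets of best approximations suffice: applied to the inverse scalar, they give the converses.
\<close>

lemma best_approx_scale:
  fixes smul :: "'k::real_normed_field \<Rightarrow> 'y::real_normed_vector \<Rightarrow> 'y"
  assumes vs: "vector_space smul"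
    and norm: "\<And>c y. norm (smul c y) = norm c * norm y"
    and X: "module.subspace smul X"
    and c: "c \<noteq> 0"
  shows "best_approx X (smul c y) = smul c ` best_approx X y"
proof -
  interpret vector_space smul by (fact vs)
  have X_ne: "X \<noteq> {}" using subspace_0[OF X] by blast
  have le: "infdist (smul c y) X \<le> norm c * infdist y X" if "c \<noteq> 0" for c y
  proof -
    have "infdist (smul c y) X / norm c \<le> dist y x" if "x \<in> X" for x
    proof -
      have "infdist (smul c y) X \<le> dist (smul c y) (smul c x)"
        using that subspace_scale[OF X] by (intro infdist_le) auto
      also have "\<dots> = norm c * dist y x"
        by (simp add: dist_norm norm flip: scale_right_diff_distrib)
      finally show ?thesis using \<open>c \<noteq> 0\<close> by (simp add: field_simps)
    qed
    then have "infdist (smul c y) X / norm c \<le> infdist y X"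
      using X_ne by (auto simp: infdist_notempty intro!: cINF_greatest)
    then show ?thesis using \<open>c \<noteq> 0\<close> by (simp add: field_simps)
  qed
  have infdist: "infdist (smul c y) X = norm c * infdist y X" if "c \<noteq> 0" for c y
  proof (rule antisym[OF le[OF that]])
    show "norm c * infdist y X \<le> infdist (smul c y) X"
      using le[of "inverse c" "smul c y"] that by (simp add: norm_inverse norm_divide field_simps)
  qed
  have sub: "smul c ` best_approx X y \<subseteq> best_approx X (smul c y)" if "c \<noteq> 0" for c y
    using that subspace_scale[OF X]
    by (auto simp: best_approx_def infdist norm simp flip: scale_right_diff_distrib)
  show ?thesis
  proof
    show "best_approx X (smul c y) \<subseteq> smul c ` best_approx X y"
    proof
      fix g assume "g \<in> best_approx X (smul c y)"
      then have "smul (inverse c) g \<in> best_approx X y"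
        using sub[of "inverse c" "smul c y"] c by auto
      moreover have "g = smul c (smul (inverse c) g)" using c by simp
      ultimately show "g \<in> smul c ` best_approx X y" by blast
    qed
  qed (rule sub[OF c])
qed

section \<open>The seminorm defined by best approximations\<close>

lemma tilde_norm_self:
  assumes "x \<in> X"
  shows "tilde_norm X nX x = nX x"
  by (simp add: tilde_norm_def best_approx_self[OF assms])

lemma bdd_above_best_approx:
  assumes "bounded_proximinal X nX"
  shows "bdd_above (nX ` best_approx X y)"
proof -
  have fin: "sup_best_approx X nX y < \<infinity>"
    using assms by (simp add: bounded_proximinal_def)
  then obtain M where M: "sup_best_approx X nX y \<le> ereal M"
    by (cases "sup_best_approx X nX y") auto
  have "nX x \<le> M" if "x \<in> best_approx X y" for x
  proof -
    have "ereal (nX x) \<le> sup_best_approx X nX y"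
      unfolding sup_best_approx_def using that by (rule SUP_upper)
    then have "ereal (nX x) \<le> ereal M" using M by (rule order_trans)
    then show ?thesis by simp
  qed
  then show ?thesis by (auto intro!: bdd_aboveI)
qed

lemma ereal_tilde_norm:
  assumes "proximinal X" and bdd: "bounded_proximinal X nX"
  shows "ereal (tilde_norm X nX y) = sup_best_approx X nX y"
proof -
  have ne: "best_approx X y \<noteq> {}"
    using assms(1) by (simp add: proximinal_def)
  then obtain x where "x \<in> best_approx X y" by blast
  then have "ereal (nX x) \<le> sup_best_approx X nX y"
    unfolding sup_best_approx_def by (rule SUP_upper)
  moreover have "sup_best_approx X nX y < \<infinity>"
    using bdd by (simp add: bounded_proximinal_def)
  ultimately have "\<bar>sup_best_approx X nX y\<bar> \<noteq> \<infinity>" by auto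
  then show ?thesis
    unfolding sup_best_approx_def tilde_norm_def by (rule ereal_SUP)
qed

lemma tilde_norm_seminorm_on:
  fixes smul :: "'k::real_normed_field \<Rightarrow> 'y::real_normed_vector \<Rightarrow> 'y"
  assumes vs: "vector_space smul"
    and norm: "\<And>c y. norm (smul c y) = norm c * norm y"
    and X: "module.subspace smul X"
    and nX: "seminorm_on X (+) smul nX"
    and tbp: "triangular_bounded_proximinal X nX"
  shows "seminorm_on UNIV (+) smul (tilde_norm X nX)"
  unfolding seminorm_on_def
proof (intro conjI ballI allI)
  interpret vector_space smul by (fact vs)
  have prox: "proximinal X" and tri: "triangular X nX" and bdd: "bounded_proximinal X nX"
    using tbp by (auto simp: triangular_bounded_proximinal_def)
  have ne: "best_approx X y \<noteq> {}" for y
    using prox by (simp add: proximinal_def)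
  have best_in: "g \<in> X" if "g \<in> best_approx X y" for g y
    using that by (simp add: best_approx_def)
  have upper: "nX g \<le> tilde_norm X nX y" if "g \<in> best_approx X y" for g y
    unfolding tilde_norm_def using that by (rule cSUP_upper[OF _ bdd_above_best_approx[OF bdd]])
  show "0 \<le> tilde_norm X nX y" for y
  proof -
    obtain g where "g \<in> best_approx X y" using ne by blast
    then show ?thesis
      using upper best_in seminorm_on_nonneg[OF nX] by (meson order_trans)
  qed
  show "tilde_norm X nX (x + y) \<le> tilde_norm X nX x + tilde_norm X nX y" for x y
  proof -
    have "ereal (tilde_norm X nX (x + y)) \<le> ereal (tilde_norm X nX x + tilde_norm X nX y)"
      using tri by (simp add: triangular_def ereal_tilde_norm[OF prox bdd] flip: plus_ereal.simps(1))
    then show ?thesis by simp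
  qed
  show "tilde_norm X nX (smul c y) = norm c * tilde_norm X nX y" for c y
  proof (cases "c = 0")
    case True
    have "nX 0 = 0"
      using seminorm_on_scale[OF nX subspace_0[OF X], of 0] by simp
    then show ?thesis
      using True tilde_norm_self[OF subspace_0[OF X]] by simp
  next
    case False
    have le: "tilde_norm X nX (smul c y) \<le> norm c * tilde_norm X nX y" if c: "c \<noteq> 0" for c y
      unfolding tilde_norm_def[of _ _ "smul c y"]
    proof (rule cSUP_least[OF ne])
      fix g assume "g \<in> best_approx X (smul c y)"
      then obtain h where "h \<in> best_approx X y" "g = smul c h"
        using best_approx_scale[OF vs norm X c] by blast
      then show "nX g \<le> norm c * tilde_norm X nX y"
        using upper best_in seminorm_on_scale[OF nX] by (simp add: mult_left_mono)
    qed
    \<comment> \<open>The reverse inequality is the same one for the scalar \<open>inverse c\<close> and the vector \<open>smul c y\<close>.\<close>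
    have "norm c * tilde_norm X nX y \<le> tilde_norm X nX (smul c y)"
      using le[of "inverse c" "smul c y"] False by (simp add: norm_inverse norm_divide field_simps)
    with le[OF False] show ?thesis by (rule antisym)
  qed
qed

section \<open>The seminorm on the ambient space and the quotient\<close>

theorem theorem3p1:
  fixes smul :: "'k::real_normed_field \<Rightarrow> 'y::real_normed_vector \<Rightarrow> 'y"
    and X :: "'y set" and nX :: "'y \<Rightarrow> real"
  assumes Y_vector_space: "vector_space smul"
    and Y_norm: "\<And>c y. norm (smul c y) = norm c * norm y"
    and X_nonempty: "X \<noteq> {}"
    and X_subspace: "module.subspace smul X"
    and X_norm: "norm_on X (+) 0 smul nX"
    and X_tbp: "triangular_bounded_proximinal X nX"
  shows "let p = tilde_norm X nX; N = null_space p in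
      seminorm_on UNIV (+) smul p
    \<and> module.subspace smul N
    \<and> vector_space_on (quot_carrier N) (+) N (quot_scale smul N)
    \<and> (\<forall>f. quot_norm p (f +o N) = p f)
    \<and> norm_on (quot_carrier N) (+) N (quot_scale smul N) (quot_norm p)
    \<and> (\<forall>f g. (f + g) +o N = (f +o N) + (g +o N))
    \<and> (\<forall>c f. smul c f +o N = quot_scale smul N c (f +o N))
    \<and> inj_on (\<lambda>f. f +o N) X
    \<and> X = LH (\<lambda>f. f +o N) X nX (quot_norm p)
    \<and> (\<forall>f\<in>X. nX f = p f)"
proof -
  interpret vector_space smul by (fact Y_vector_space)
  define p where "p = tilde_norm X nX"
  define N where "N = null_space p"
  have p: "seminorm_on UNIV (+) smul p"
    unfolding p_def
    using tilde_norm_seminorm_on[OF Y_vector_space Y_norm X_subspace _ X_tbp] X_norm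
    by (simp add: norm_on_def)
  have N: "module.subspace smul N"
    unfolding N_def by (rule null_space_subspace[OF Y_vector_space p])
  have quot_norm: "quot_norm p (f +o N) = p f" for f
    unfolding N_def by (rule quot_norm_coset[OF Y_vector_space p])
  have p_X: "nX f = p f" if "f \<in> X" for f
    using tilde_norm_self[OF that] by (simp add: p_def)
  have inj: "inj_on (\<lambda>f. f +o N) X"
  proof (rule inj_onI)
    fix f g assume fg: "f \<in> X" "g \<in> X" "f +o N = g +o N"
    then have "f - g \<in> X" "p (f - g) = 0"
      using subspace_diff[OF X_subspace] coset_eq_iff[OF N] by (auto simp: N_def null_space_def)
    then have "f - g = 0"
      using X_norm p_X[of "f - g"] by (simp add: norm_on_def del: right_minus_eq)
    then show "f = g" by simp
  qed
  have LH: "X = LH (\<lambda>f. f +o N) X nX (quot_norm p)"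
    using p_X by (auto simp: LH_def quot_norm)
  have norm: "norm_on (quot_carrier N) (+) N (quot_scale smul N) (quot_norm p)"
    unfolding N_def by (rule quotient_norm_on[OF Y_vector_space p])
  show ?thesis
    unfolding Let_def p_def[symmetric] N_def[symmetric]
    using p N quotient_vector_space_on[OF N] quot_norm norm coset_add[OF N] coset_scale[OF N]
      inj LH p_X
    by blast
qed

end
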